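(* For all integers $m\ge 2$ and $2\le k\le m$, $$c_{mk} = (k-2)!\sum_{l=2}^m {l-1 \brace k-1} (-1)^{l-k},$$ where ${a \brace b}$ denotes the Stirling number of the second kind.
   Context: For an integer $k\ge 2$ let $\psi_k(n) = n + (k-1)(n-1)B_{n-1,k-1}$, where $B_{a,b}=\frac{(a+b)!}{a!\,b!}$, for positive integers $n$; equivalently $\psi_k$ is the polynomial of degree $k$ in $n$ given by $\psi_k(n) = n + \frac{n-1}{(k-2)!}\prod_{j=0}^{k-2}(n+j)$. For $m\ge 2$, the coefficients $c_{mk}$ ($2\le k\le m$) are the unique rational numbers defined by the polynomial identity $n^m = \sum_{k=2}^m c_{mk}\psi_k(n)$. *)

theory Defs
  imports
    "HOL-Computational_Algebra.Polynomial"
    "HOL-Combinatorics.Stirling"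
begin

definition binom_B :: "nat \<Rightarrow> nat \<Rightarrow> rat" where
  "binom_B a b = fact (a + b) / (fact a * fact b)"

text \<open>The value \<open>\<psi>\<^sub>k(n)\<close>, meaningful for \<open>k \<ge> 2\<close> and \<open>n \<ge> 1\<close>
  (the subtractions inside \<open>binom_B\<close> are on naturals).\<close>

definition psi :: "nat \<Rightarrow> nat \<Rightarrow> rat" where
  "psi k n = of_nat n + (of_nat k - 1) * (of_nat n - 1) * binom_B (n - 1) (k - 1)"

text \<open>The polynomial \<open>n + (n - 1) / (k - 2)! * (\<Prod>j=0..k-2. n + j)\<close> in the indeterminate
  \<open>n = [:0, 1:]\<close>, which interpolates \<open>psi k\<close> at the positive integers; for \<open>k \<ge> 2\<close>.\<close>

definition psi_poly :: "nat \<Rightarrow> rat poly" where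
  "psi_poly k =
     [:0, 1:] + smult (1 / fact (k - 2)) ([:-1, 1:] * (\<Prod>j=0..k-2. [:of_nat j, 1:]))"

lemma poly_psi_poly_eq_psi:
  assumes "2 \<le> k" "1 \<le> n"
  shows "poly (psi_poly k) (of_nat n) = psi k n"
proof -
  obtain i where k: "k = Suc (Suc i)" using assms(1) by (metis add_2_eq_Suc le_Suc_ex)
  obtain r where n: "n = Suc r" using assms(2) by (metis Suc_le_D One_nat_def)
  have P: "(\<Prod>j=0..i. of_nat j + (of_nat r + 1)) * fact r = (fact (Suc (r + i)) :: rat)" for i
  proof (induction i)
    case (Suc i)
    have "(\<Prod>j=0..Suc i. of_nat j + (of_nat r + 1)) * fact r =
        (of_nat (Suc i) + (of_nat r + 1)) * ((\<Prod>j=0..i. of_nat j + (of_nat r + 1)) * fact r :: rat)"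
      by simp
    also have "\<dots> = fact (Suc (r + Suc i))"
      unfolding Suc.IH by (subst (2) fact_Suc) (simp add: add_ac del: fact_Suc)
    finally show ?case .
  qed (simp add: algebra_simps)
  have "poly (psi_poly k) (of_nat n) =
      of_nat n + of_nat r * (\<Prod>j=0..i. of_nat j + (of_nat r + 1)) / fact i"
    by (simp add: k n psi_poly_def poly_prod add_ac) (simp add: algebra_simps)
  also have "(\<Prod>j=0..i. of_nat j + (of_nat r + 1)) = (fact (Suc (r + i)) :: rat) / fact r"
    using P[of i] by (simp add: field_simps del: fact_Suc)
  finally have "poly (psi_poly k) (of_nat n) =
      of_nat n + of_nat r * (fact (Suc (r + i)) / fact r) / fact i" .
  moreover have "psi k n =
      of_nat n + of_nat (Suc i) * of_nat r * (fact (Suc (r + i)) / (fact r * fact (Suc i)))"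
    by (simp add: k n psi_def binom_B_def del: fact_Suc)
  moreover have "of_nat (Suc i) * a * (b / (c * fact (Suc i))) = a * (b / c) / fact i" for a b c :: rat
    by (simp del: of_nat_Suc)
  ultimately show ?thesis by simp
qed

text \<open>\<open>c_coeffs m\<close> is the family \<open>(c\<^sub>m\<^sub>k)\<^sub>k\<close>; a family indexed by
  \<open>2 \<le> k \<le> m\<close> is encoded as a function that is \<open>0\<close> outside this range.
  The definite description is justified by \<open>c_coeffs_ex1\<close> below.\<close>

definition is_c_coeffs :: "nat \<Rightarrow> (nat \<Rightarrow> rat) \<Rightarrow> bool" where
  "is_c_coeffs m f \<longleftrightarrow>
     (\<forall>k. k \<notin> {2..m} \<longrightarrow> f k = 0) \<and>
     [:0, 1:] ^ m = (\<Sum>k=2..m. smult (f k) (psi_poly k))"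

definition c_coeffs :: "nat \<Rightarrow> nat \<Rightarrow> rat" where
  "c_coeffs m = (THE f. is_c_coeffs m f)"

lemma psi_poly_coeff:
  assumes "2 \<le> k"
  shows "coeff (psi_poly k) 0 = 0" "coeff (psi_poly k) (Suc 0) = 0"
    and "degree (psi_poly k) \<le> k" "coeff (psi_poly k) k \<noteq> 0"
proof -
  define i where "i = k - 2"
  have k: "k = Suc (Suc i)" using assms by (simp add: i_def)
  define Q :: "rat poly" where "Q = (\<Prod>j=Suc 0..i. [:of_nat j, 1:])"
  have Q0: "coeff Q 0 = fact i"
    by (simp add: Q_def poly_0_coeff_0[symmetric] poly_prod fact_prod)
  have dQ: "degree Q = i" "coeff Q i = 1"
  proof -
    show 1: "degree Q = i" unfolding Q_def by (subst degree_prod_sum_eq) auto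
    have "lead_coeff Q = 1" unfolding Q_def by (subst lead_coeff_prod) auto
    then show "coeff Q i = 1" using 1 by simp
  qed
  have "(\<Prod>j=0..i. [:of_nat j, 1:]) = [:0, 1:] * Q"
    by (simp add: Q_def prod.atLeast_Suc_atMost)
  then have psi: "psi_poly k = [:0, 1:] + smult (1 / fact i) ([:-1, 1:] * ([:0, 1:] * Q))"
    by (simp add: psi_poly_def k)
  show "coeff (psi_poly k) 0 = 0" by (simp add: psi)
  show "coeff (psi_poly k) (Suc 0) = 0" by (simp add: psi Q0)
  have "coeff Q (Suc i) = 0" using dQ(1) by (simp add: coeff_eq_0)
  then show "coeff (psi_poly k) k \<noteq> 0" by (simp add: psi[unfolded k] k dQ)
  have "degree ([:-1, 1:] * ([:0, 1:] * Q)) \<le> k"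
    by (intro order.trans[OF degree_mult_le]) (use dQ(1) in \<open>simp add: k\<close>)
  then show "degree (psi_poly k) \<le> k"
    unfolding psi by (intro degree_add_le order.trans[OF degree_smult_le]) (auto simp: k)
qed

lemma psi_poly_basis:
  fixes p :: "rat poly"
  assumes "degree p \<le> m" "coeff p 0 = 0" "coeff p (Suc 0) = 0"
  shows "\<exists>!f. (\<forall>k. k \<notin> {2..m} \<longrightarrow> f k = 0) \<and> p = (\<Sum>k=2..m. smult (f k) (psi_poly k))"
  using assms
proof (induction m arbitrary: p)
  case 0
  then have "p = 0" by (auto elim: degree_eq_zeroE)
  then show ?case by (intro ex1I[of _ "\<lambda>_. 0"]) auto
next
  case (Suc m)
  show ?case
  proof (cases "m = 0")
    case True
    have "p = 0"
    proof (rule poly_eqI)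
      fix n show "coeff p n = coeff 0 n"
        using Suc.prems True coeff_eq_0[of p n] by (cases "n \<le> 1") (auto simp: le_Suc_eq)
    qed
    then show ?thesis using True by (intro ex1I[of _ "\<lambda>_. 0"]) auto
  next
    case False
    then have m: "2 \<le> Suc m" by simp
    note c = psi_poly_coeff[OF m]
    have split: "{2..Suc m} = insert (Suc m) {2..m}" using m by auto
    define a where "a = coeff p (Suc m) / coeff (psi_poly (Suc m)) (Suc m)"
    define q where "q = p - smult a (psi_poly (Suc m))"
    have dq: "degree q \<le> m"
    proof (rule degree_le, intro allI impI)
      fix i assume "m < i"
      then consider "i = Suc m" | "i > Suc m" by linarith
      then show "coeff q i = 0"
      proof cases
        case 1 then show ?thesis using c(4) by (simp add: q_def a_def)
      next
        case 2 then show ?thesis using c(3) Suc.prems(1) by (simp add: q_def coeff_eq_0)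
      qed
    qed
    have q0: "coeff q 0 = 0" "coeff q (Suc 0) = 0"
      using c Suc.prems by (simp_all add: q_def)
    let ?S = "\<lambda>f. (\<Sum>k=2..m. smult (f k) (psi_poly k))"
    obtain f where f: "\<And>k. k \<notin> {2..m} \<Longrightarrow> f k = 0" "q = ?S f"
      and uniq: "\<And>g. (\<forall>k. k \<notin> {2..m} \<longrightarrow> g k = 0) \<Longrightarrow> q = ?S g \<Longrightarrow> g = f"
      using Suc.IH[OF dq q0] by (elim ex1E) blast
    have upd: "?S (g(Suc m := x)) = ?S g" for g x by (intro sum.cong) auto
    show ?thesis
    proof (intro ex1I conjI allI impI)
      fix k assume "k \<notin> {2..Suc m}"
      then show "(f(Suc m := a)) k = 0" using f(1) m by auto
    next
      have "q + smult a (psi_poly (Suc m)) = (\<Sum>k=2..Suc m. smult ((f(Suc m := a)) k) (psi_poly k))"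
        unfolding split by (subst sum.insert) (simp_all add: upd f(2) del: fun_upd_apply, simp)
      then show "p = (\<Sum>k=2..Suc m. smult ((f(Suc m := a)) k) (psi_poly k))"
        by (simp add: q_def)
    next
      fix g assume g: "(\<forall>k. k \<notin> {2..Suc m} \<longrightarrow> g k = 0) \<and>
        p = (\<Sum>k=2..Suc m. smult (g k) (psi_poly k))"
      then have p: "p = smult (g (Suc m)) (psi_poly (Suc m)) + ?S g"
        unfolding split by (subst (asm) sum.insert) auto
      have "coeff (?S g) (Suc m) = 0"
        unfolding coeff_sum
      proof (intro sum.neutral ballI)
        fix k assume "k \<in> {2..m}"
        then show "coeff (smult (g k) (psi_poly k)) (Suc m) = 0"
          using psi_poly_coeff(3)[of k] by (simp add: coeff_eq_0)
      qed
      then have a: "g (Suc m) = a" using c(4) by (simp add: a_def p)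
      have "g(Suc m := 0) = f"
      proof (rule uniq)
        show "\<forall>k. k \<notin> {2..m} \<longrightarrow> (g(Suc m := 0)) k = 0" using g by (auto simp: le_Suc_eq)
        show "q = ?S (g(Suc m := 0))" unfolding upd q_def using p a by simp
      qed
      then show "g = f(Suc m := a)" using a by auto
    qed
  qed
qed

lemma c_coeffs_ex1:
  assumes "2 \<le> m"
  shows "\<exists>!f. is_c_coeffs m f"
proof -
  have "[:0, 1:] ^ m = (monom 1 m :: rat poly)" by (simp add: monom_altdef)
  then show ?thesis
    unfolding is_c_coeffs_def using assms
    by (intro psi_poly_basis) (simp_all add: degree_monom_eq)
qed

end

theory Submission
  imports Defs
begin

text \<open>
  Write \<open>x\<close> for the indeterminate and \<open>R\<^sub>j\<close> for the rising factorial \<open>pochhammer x j\<close>.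
  By definition \<open>(k-2)! (\<psi>\<^sub>k - x) = (x - 1) R\<^bsub>k-1\<^esub>\<close>, so up to multiples of \<open>x\<close> an expansion of
  \<open>x ^ m\<close> in the \<open>\<psi>\<^sub>k\<close> amounts to an expansion of \<open>(x ^ m - x) / (x - 1)\<close> in rising factorials.
  This quotient is the geometric sum of the powers \<open>x ^ (l - 1)\<close> for \<open>2 \<le> l \<le> m\<close>, and each power
  expands in rising factorials with signed Stirling numbers of the second kind
  (\<open>power_eq_sum_Stirling_pochhammer\<close>). Collecting the coefficient of \<open>R\<^bsub>k-1\<^esub>\<close> gives the
  coefficients of the theorem, and with them \<open>\<Sum>\<^sub>k c\<^sub>k \<psi>\<^sub>k = x ^ m + (C - 1) x\<close>, where
  \<open>C = \<Sum>\<^sub>k c\<^sub>k\<close>. The stray multiple of \<open>x\<close> vanishes because no \<open>\<psi>\<^sub>k\<close> has a linear term: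
  comparing linear coefficients yields \<open>C = 1\<close>. Uniqueness of the expansion
  (\<open>c_coeffs_ex1\<close>) then identifies the coefficients with \<open>c_coeffs m\<close>.
\<close>

text \<open>The expansion reflects that multiplication by \<open>x\<close> acts on rising factorials by
  \<open>x * pochhammer x j = pochhammer x (Suc j) - j * pochhammer x j\<close>, which is the recurrence of the
  Stirling numbers up to the sign. The sign is written with exponent \<open>n + j\<close> instead of
  \<open>n - j\<close>, which has the same parity, to avoid truncated subtraction.\<close>

lemma power_eq_sum_Stirling_pochhammer:
  fixes x :: "'a::comm_ring_1"
  shows "x ^ n = (\<Sum>j\<le>n. (-1) ^ (n + j) * of_nat (Stirling n j) * pochhammer x j)"
proof (induction n)
  case (Suc n)
  define t where "t j = (-1) ^ (n + j) * of_nat (Stirling n j) * pochhammer x j" for j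
  define u where
    "u j = (-1) ^ (Suc n + j) * of_nat (j * Stirling n j) * pochhammer x j" for j
  have step: "x * t j = (-1) ^ (n + j) * of_nat (Stirling n j) * pochhammer x (Suc j) + u j" for j
    unfolding t_def u_def pochhammer_Suc by (simp add: algebra_simps)
  have "x ^ Suc n = (\<Sum>j\<le>n. x * t j)"
    unfolding power_Suc Suc.IH t_def by (simp add: sum_distrib_left)
  also have "\<dots> = (\<Sum>j\<le>n. (-1) ^ (n + j) * of_nat (Stirling n j) * pochhammer x (Suc j))
      + (\<Sum>j\<le>n. u j)"
    by (simp add: step sum.distrib)
  also have "(\<Sum>j\<le>n. u j) = (\<Sum>j\<le>n. u (Suc j))"
  proof -
    have "(\<Sum>j\<le>n. u j) = (\<Sum>j\<le>Suc n. u j)" by (simp add: u_def)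
    also have "\<dots> = (\<Sum>j\<le>n. u (Suc j))"
      by (subst sum.atMost_Suc_shift) (simp add: u_def)
    finally show ?thesis .
  qed
  also have "(\<Sum>j\<le>n. (-1) ^ (n + j) * of_nat (Stirling n j) * pochhammer x (Suc j))
      + (\<Sum>j\<le>n. u (Suc j))
      = (\<Sum>j\<le>n. (-1) ^ (Suc n + Suc j) * of_nat (Stirling (Suc n) (Suc j)) * pochhammer x (Suc j))"
    unfolding sum.distrib[symmetric] u_def
    by (intro sum.cong) (simp_all add: algebra_simps del: pochhammer_Suc)
  also have "\<dots> = (\<Sum>j\<le>Suc n.
      (-1) ^ (Suc n + j) * of_nat (Stirling (Suc n) j) * pochhammer x j)"
    by (subst sum.atMost_Suc_shift) simp
  finally show ?case .
qed simp

lemma psi_poly_eq_pochhammer: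
  assumes "2 \<le> k"
  shows "psi_poly k =
    [:0, 1:] + smult (1 / fact (k - 2)) ([:-1, 1:] * pochhammer [:0, 1:] (k - 1))"
proof -
  have "{0..k - 2} = {0..<k - 1}" using assms by auto
  then show ?thesis
    by (simp add: psi_poly_def pochhammer_prod of_nat_poly)
qed

lemma power_minus_self_eq:
  fixes x :: "'a::comm_ring_1"
  assumes "1 \<le> m"
  shows "x ^ m - x = (x - 1) * (\<Sum>l=2..m. x ^ (l - 1))"
  using assms
proof (induction m rule: dec_induct)
  case (step n)
  then have "{2..Suc n} = insert (Suc n) {2..n}" by auto
  then have "(x - 1) * (\<Sum>l=2..Suc n. x ^ (l - 1)) = (x - 1) * x ^ n + (x ^ n - x)"
    using step.IH by (simp add: distrib_left)
  then show ?case by (simp add: algebra_simps)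
qed simp

theorem mainTheorem1:
  fixes m k :: nat
  assumes "2 \<le> m" and "2 \<le> k" and "k \<le> m"
  shows "c_coeffs m k =
    fact (k - 2) *
      (\<Sum>l=2..m. of_nat (Stirling (l - 1) (k - 1)) * (-1) powi (int l - int k))"
proof -
  define X :: "rat poly" where "X = [:0, 1:]"
  define a :: "nat \<Rightarrow> rat" where
    "a k = (\<Sum>l=2..m. of_nat (Stirling (l - 1) (k - 1)) * (-1) powi (int l - int k))" for k
  define c where "c k = (if k \<in> {2..m} then fact (k - 2) * a k else 0)" for k
  have X1: "[:-1, 1:] = X - 1" by (simp add: X_def one_pCons)
  have power: "X ^ (l - 1) = (\<Sum>k=2..m. smult
      (of_nat (Stirling (l - 1) (k - 1)) * (-1) powi (int l - int k)) (pochhammer X (k - 1)))"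
    if l: "l \<in> {2..m}" for l
  proof -
    let ?s = "\<lambda>j. (-1) ^ (l - 1 + j) * of_nat (Stirling (l - 1) j) * pochhammer X j"
    have "X ^ (l - 1) = sum ?s {..l - 1}" by (rule power_eq_sum_Stirling_pochhammer)
    \<comment> \<open>The index \<open>0\<close> contributes nothing as \<open>l - 1 > 0\<close>, and neither do indices above \<open>l - 1\<close>.\<close>
    also have "\<dots> = sum ?s {1..m - 1}"
    proof (rule sum.mono_neutral_cong)
      fix j assume "j \<in> {..l - 1} - {1..m - 1}"
      then have "j = 0" using l by auto
      moreover obtain i where "l - 1 = Suc i" using l by (cases "l - 1") auto
      ultimately show "?s j = 0" by simp
    qed auto
    also have "\<dots> = (\<Sum>k=2..m. ?s (k - 1))"
      using assms(1) by (intro sum.reindex_bij_witness[of _ "\<lambda>k. k - 1" Suc]) auto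
    also have "\<dots> = (\<Sum>k=2..m. smult
      (of_nat (Stirling (l - 1) (k - 1)) * (-1) powi (int l - int k)) (pochhammer X (k - 1)))"
    proof (rule sum.cong[OF refl])
      fix k assume k: "k \<in> {2..m}"
      have "(-1) powi (int l - int k) = ((-1) ^ (l - 1 + (k - 1)) :: rat)"
        using l k by (simp add: power_int_diff minus_one_power_iff)
      then show "?s (k - 1) = smult
        (of_nat (Stirling (l - 1) (k - 1)) * (-1) powi (int l - int k)) (pochhammer X (k - 1))"
        using l k by (auto simp: minus_one_power_iff of_nat_poly)
    qed
    finally show ?thesis .
  qed
  have geometric: "(\<Sum>k=2..m. smult (a k) (pochhammer X (k - 1))) = (\<Sum>l=2..m. X ^ (l - 1))"
  proof -
    have "(\<Sum>l=2..m. X ^ (l - 1)) = (\<Sum>l=2..m. \<Sum>k=2..m. smult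
      (of_nat (Stirling (l - 1) (k - 1)) * (-1) powi (int l - int k)) (pochhammer X (k - 1)))"
      by (intro sum.cong power refl)
    also have "\<dots> = (\<Sum>k=2..m. smult (a k) (pochhammer X (k - 1)))"
      by (subst sum.swap) (simp add: a_def smult_sum)
    finally show ?thesis by simp
  qed
  have "(\<Sum>k=2..m. smult (c k) (psi_poly k))
      = (\<Sum>k=2..m. smult (c k) X + (X - 1) * smult (a k) (pochhammer X (k - 1)))"
    by (intro sum.cong refl)
       (simp add: c_def psi_poly_eq_pochhammer X1 X_def[symmetric] smult_add_right)
  also have "\<dots> = smult (\<Sum>k=2..m. c k) X
      + (X - 1) * (\<Sum>k=2..m. smult (a k) (pochhammer X (k - 1)))"
    by (simp only: sum.distrib smult_sum sum_distrib_left)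
  also have "\<dots> = smult (\<Sum>k=2..m. c k) X + (X ^ m - X)"
    using assms(1) by (simp only: geometric power_minus_self_eq)
  finally have expansion: "(\<Sum>k=2..m. smult (c k) (psi_poly k))
      = smult (\<Sum>k=2..m. c k) X + (X ^ m - X)" .
  have "coeff (\<Sum>k=2..m. smult (c k) (psi_poly k)) 1 = 0"
    by (simp add: coeff_sum psi_poly_coeff(2))
  moreover have "coeff (X ^ m) 1 = 0"
    using assms(1) by (simp add: X_def monom_altdef[of 1, simplified, symmetric])
  ultimately have "(\<Sum>k=2..m. c k) = 1"
    unfolding expansion by (simp add: X_def)
  then have "is_c_coeffs m c"
    unfolding is_c_coeffs_def using expansion by (auto simp: c_def X_def)
  then have "c_coeffs m = c"
    unfolding c_coeffs_def by (rule the1_equality[OF c_coeffs_ex1[OF assms(1)]])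
  then show ?thesis using assms by (simp add: c_def a_def)
qed

end
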